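(* Let $n\ge 1$ and $K,L\in\mathbb{N}$. The signed hypergeometric channels satisfy: 1. $\mathrm{shg}[K](\mathbf{0})$, where $\mathbf{0}$ is the empty multiset on $\mathbf{n}$, is the uniform distribution on $\mathcal{M}[K](\mathbf{n})$. 2. If $K\ge1$, then $\mathrm{flrn}\circ\mathrm{shg}[K]=\mathrm{flrn}$ as signed channels from the set of non-empty multisets on $\mathbf{n}$ to $\mathbf{n}$; that is, $\sum_{\varphi\in\mathcal{M}[K](\mathbf{n})}\mathrm{shg}[K](\upsilon)(\varphi)\cdot\mathrm{flrn}(\varphi)(i)=\mathrm{flrn}(\upsilon)(i)$ for every non-empty multiset $\upsilon$ on $\mathbf{n}$ and $i\in\mathbf{n}$. 3. $\mathrm{shg}[K]\circ\mathrm{mn}[L+K]=\mathrm{mn}[K]$ as channels from $\Delta^n$ to $\mathcal{M}[K](\mathbf{n})$. 4. $\mathrm{shg}[K]\circ\mathrm{shg}[K+L]=\mathrm{shg}[K]$ as signed channels from $\mathcal{M}(\mathbf{n})$ to $\mathcal{M}[K](\mathbf{n})$. 5. $\mathrm{DD}\circ\mathrm{shg}[K+1]=\mathrm{shg}[K]$ as signed channels from $\mathcal{M}(\mathbf{n})$ to $\mathcal{M}[K](\mathbf{n})$.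
   Context: For $n\ge1$ let $\mathbf{n}=\{0,\dots,n-1\}$. A multiset on $\mathbf{n}$ is a function $\varphi:\mathbf{n}\to\mathbb{N}$; $\mathcal{M}(\mathbf{n})$ is the set of all multisets, $\|\varphi\|=\sum_i\varphi(i)$ is the size, $\mathcal{M}[K](\mathbf{n})$ is the set of multisets of size $K$, and $\varphi!=\prod_i\varphi(i)!$. A signed distribution on a set $X$ is a function $\sigma:X\to\mathbb{R}$ with finite support and $\sum_x\sigma(x)=1$. A signed channel from $X$ to $Y$ assigns to each $x\in X$ a signed distribution $c(x)$ on $Y$. Composition of channels $c$ from $X$ to $Y$ and $d$ from $Y$ to $Z$ is $(d\circ c)(x)(z)=\sum_{y}c(x)(y)\cdot d(y)(z)$; if $c(x)$ is supported on a subset $Y'\subseteq Y$ (for instance $\mathcal{M}[K+L](\mathbf{n})\subseteq\mathcal{M}(\mathbf{n})$), $d$ need only be defined on $Y'$. Simplex: $\Delta^n=\{\vec r\in\mathbb{R}_{\ge0}^n\mid\sum_i r_i=1\}$. Integrals over $\Delta^n$ are with respect to Lebesgue measure in the coordinates $(r_0,\dots,r_{n-2})$ (a point mass $1$ if $n=1$), so that $\int_{\Delta^n}\prod_i r_i^{\varphi(i)}\,d\vec r=\frac{\varphi!}{(\|\varphi\|+n-1)!}$ for every multiset $\varphi$. For $\varphi\in\mathcal{M}[K](\mathbf{n})$ let $\mathfrak{m}_\varphi:\Delta^n\to\mathbb{R}$, $\mathfrak{m}_\varphi(\vec r)=\frac{K!}{\varphi!}\prod_i r_i^{\varphi(i)}$.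 The multinomial channel $\mathrm{mn}[K]$ from $\Delta^n$ to $\mathcal{M}[K](\mathbf{n})$ is $\mathrm{mn}[K](\vec r)(\varphi)=\mathfrak{m}_\varphi(\vec r)$. Let $P_K(\Delta^n)$ be the real vector space of functions on $\Delta^n$ spanned by the $\mathfrak{m}_\varphi$, $\varphi\in\mathcal{M}[K](\mathbf{n})$ (these form a basis), with inner product $\langle f,g\rangle=\int_{\Delta^n}f(\vec r)g(\vec r)\,d\vec r$. The dual multinomials $(\mathfrak{d}_\psi)_{\psi\in\mathcal{M}[K](\mathbf{n})}$ are the unique elements of $P_K(\Delta^n)$ with $\langle\mathfrak{m}_\varphi,\mathfrak{d}_\psi\rangle=\delta_{\varphi,\psi}$ for all $\varphi,\psi\in\mathcal{M}[K](\mathbf{n})$. Thus for any multiset $\upsilon$, $\mathfrak{d}_\upsilon\in P_{\|\upsilon\|}(\Delta^n)$. Signed hypergeometric: for any $\upsilon\in\mathcal{M}(\mathbf{n})$ and any $K\in\mathbb{N}$, $\mathrm{shg}[K](\upsilon)$ is the signed distribution on $\mathcal{M}[K](\mathbf{n})$ given by $\mathrm{shg}[K](\upsilon)(\varphi)=\int_{\Delta^n}\mathfrak{m}_\varphi(\vec r)\,\mathfrak{d}_\upsilon(\vec r)\,d\vec r$. Frequentist learning: for a non-empty multiset $\varphi$, $\mathrm{flrn}(\varphi)(i)=\varphi(i)/\|\varphi\|$, a distribution on $\mathbf{n}$. Draw-delete: the channel $\mathrm{DD}$ from $\mathcal{M}[K+1](\mathbf{n})$ to $\mathcal{M}[K](\mathbf{n})$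 assigns to $\upsilon$ the distribution giving, for each $i$ with $\upsilon(i)>0$, probability $\frac{\upsilon(i)}{K+1}$ to the multiset obtained from $\upsilon$ by lowering the multiplicity of $i$ by one (and probability $0$ to all other multisets). *)

theory Defs
  imports
    "HOL-Analysis.Analysis"
    "HOL-Library.Function_Algebras"
    "HOL-Library.Multiset"
    "HOL-Probability.Probability_Mass_Function"
begin

text \<open>
  A multiset on \<open>n = {0, \<dots>, n - 1}\<close> is a library multiset of natural numbers all of
  whose elements lie in \<open>{..<n}\<close>; the multiplicity function is \<^term>\<open>count\<close>.
\<close>

definition multisets_on :: "nat \<Rightarrow> nat multiset set" where
  "multisets_on n = {\<phi>. set_mset \<phi> \<subseteq> {..<n}}"

abbreviation multisets_on_of_size :: "nat \<Rightarrow> nat \<Rightarrow> nat multiset set" where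
  "multisets_on_of_size n K \<equiv> multisets_of_size {..<n} K"

text \<open>
  A signed channel from \<open>X\<close> to \<open>Y\<close> is represented by \<open>c :: 'a \<Rightarrow> 'b \<Rightarrow> real\<close>, where
  \<open>c x y\<close> is the value at \<open>y\<close> of the signed distribution \<open>c x\<close>, for \<open>x \<in> X\<close>;
  \<open>c x\<close> vanishes outside \<open>Y\<close>. Composition sums over the support of \<open>c x\<close>, which is
  finite for signed distributions.
\<close>

type_synonym ('a, 'b) channel = "'a \<Rightarrow> 'b \<Rightarrow> real"

definition channel_comp :: "('b, 'c) channel \<Rightarrow> ('a, 'b) channel \<Rightarrow> ('a, 'c) channel"
    (infixl "\<circ>\<^sub>c" 55) where
  "(d \<circ>\<^sub>c c) x z = (\<Sum>y | c x y \<noteq> 0. c x y * d y z)"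

text \<open>Vectors \<open>(r 0, \<dots>, r (n - 1))\<close> are extensional functions on \<open>{..<n}\<close>.\<close>

definition simplex_vec :: "nat \<Rightarrow> (nat \<Rightarrow> real) set" where
  "simplex_vec n = {r \<in> {..<n} \<rightarrow>\<^sub>E {0..}. (\<Sum>i<n. r i) = 1}"

text \<open>
  The integral uses Lebesgue measure in the coordinates \<open>0, \<dots>, n - 2\<close>; the last coordinate
  is determined by the others. For \<open>n = 1\<close> the product measure over the empty index set is
  a point mass of weight \<open>1\<close>.
\<close>

definition complete_vec :: "nat \<Rightarrow> (nat \<Rightarrow> real) \<Rightarrow> (nat \<Rightarrow> real)" where
  "complete_vec n x = x(n - 1 := 1 - (\<Sum>i<n - 1. x i))"

definition simplex_integral :: "nat \<Rightarrow> ((nat \<Rightarrow> real) \<Rightarrow> real) \<Rightarrow> real" where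
  "simplex_integral n f =
    (LINT x : {x. complete_vec n x \<in> simplex_vec n} | PiM {..<n - 1} (\<lambda>_. lborel).
       f (complete_vec n x))"

definition simplex_inner ::
    "nat \<Rightarrow> ((nat \<Rightarrow> real) \<Rightarrow> real) \<Rightarrow> ((nat \<Rightarrow> real) \<Rightarrow> real) \<Rightarrow> real" where
  "simplex_inner n f g = simplex_integral n (\<lambda>r. f r * g r)"

text \<open>
  A real function on the simplex is represented by its extension by \<open>0\<close>, so that equality
  of representatives is equality of functions on the simplex.
\<close>

definition multinomial_fun :: "nat \<Rightarrow> nat multiset \<Rightarrow> (nat \<Rightarrow> real) \<Rightarrow> real" where
  "multinomial_fun n \<phi> r =
    (if r \<in> simplex_vec n
     then fact (size \<phi>) / (\<Prod>i<n. fact (count \<phi> i)) * (\<Prod>i<n. r i ^ count \<phi> i)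
     else 0)"

definition multinomial_channel :: "nat \<Rightarrow> nat \<Rightarrow> (nat \<Rightarrow> real, nat multiset) channel" where
  "multinomial_channel n K r \<phi> =
    (if \<phi> \<in> multisets_on_of_size n K then multinomial_fun n \<phi> r else 0)"

interpretation fun_space: vector_space "\<lambda>(a :: real) (f :: (nat \<Rightarrow> real) \<Rightarrow> real) r. a * f r"
  by unfold_locales (auto simp: fun_eq_iff algebra_simps)

definition simplex_polys :: "nat \<Rightarrow> nat \<Rightarrow> ((nat \<Rightarrow> real) \<Rightarrow> real) set" where
  "simplex_polys n K = fun_space.span (multinomial_fun n ` multisets_on_of_size n K)"

definition dual_multinomial :: "nat \<Rightarrow> nat multiset \<Rightarrow> (nat \<Rightarrow> real) \<Rightarrow> real" where
  "dual_multinomial n \<psi> =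
    (THE d. d \<in> simplex_polys n (size \<psi>) \<and>
       (\<forall>\<phi> \<in> multisets_on_of_size n (size \<psi>).
          simplex_inner n (multinomial_fun n \<phi>) d = (if \<phi> = \<psi> then 1 else 0)))"

definition shg :: "nat \<Rightarrow> nat \<Rightarrow> (nat multiset, nat multiset) channel" where
  "shg n K \<upsilon> \<phi> =
    (if \<phi> \<in> multisets_on_of_size n K
     then simplex_integral n (\<lambda>r. multinomial_fun n \<phi> r * dual_multinomial n \<upsilon> r)
     else 0)"

definition flrn :: "(nat multiset, nat) channel" where
  "flrn \<phi> i = real (count \<phi> i) / real (size \<phi>)"

text \<open>Distinct \<open>i \<in># \<upsilon>\<close> give distinct multisets \<open>\<upsilon> - {#i#}\<close>, so the sum has at most one
  nonzero term.\<close>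

definition draw_delete :: "nat \<Rightarrow> (nat multiset, nat multiset) channel" where
  "draw_delete K \<upsilon> \<phi> =
    (\<Sum>i \<in> set_mset \<upsilon>. if \<phi> = \<upsilon> - {#i#} then real (count \<upsilon> i) / real (K + 1) else 0)"

end

theory Submission
  imports Defs
begin

text \<open>
  The Gram matrix of the multinomials is given by the Dirichlet integral, and the Vandermonde
  identity \<open>(p + q)! = p! q! (\<Sum>k. (p choose k) (q choose k))\<close> turns its quadratic form into a sum
  of squares. Hence it is definite, and the dual multinomials exist and are characterised by
  \<open>\<langle>\<Sum>\<phi>. a \<phi> * m \<phi>, d \<upsilon>\<rangle> = a \<upsilon>\<close>, the sum ranging over multisets of the size of \<open>\<upsilon>\<close>. Composing
  \<open>shg[K]\<close> with a channel \<open>c\<close> amounts to pairing \<open>d \<upsilon>\<close> with \<open>\<Sum>\<phi>. c \<phi> z * m \<phi>\<close>, so every identity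
  reduces to one between functions on the simplex. Those all follow from
  \<open>(\<phi> i + 1) * m (\<phi> + {i}) = (K + 1) * r i * m \<phi>\<close> and \<open>\<Sum>i. r i = 1\<close>: the multinomials of size \<open>K\<close>
  sum to \<open>1\<close>, have mean \<open>r\<close>, and \<open>m \<phi>\<close> is the draw-delete combination of those of size \<open>K + 1\<close>.
\<close>

section \<open>The Dirichlet integral over the simplex\<close>

lemma has_real_derivative_power_diff:
  "((\<lambda>x. (t - x) ^ Suc c) has_real_derivative - (real (Suc c) * (t - x) ^ c)) (at x within S)"
proof -
  have "((\<lambda>x. t - x) has_real_derivative -1) (at x within S)"
    by (auto intro!: derivative_eq_intros)
  from DERIV_power[OF this, of "Suc c"] show ?thesis by simp
qed

text \<open>The beta integral rescaled to \<open>{0..t}\<close>. Integration by parts lowers the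
  power of \<open>x\<close> and raises that of \<open>t - x\<close>, so the induction on
  \<open>a\<close> keeps \<open>c\<close> arbitrary.\<close>

lemma has_integral_power_times_power:
  fixes t :: real
  assumes "0 \<le> t"
  shows "((\<lambda>x. x ^ a * (t - x) ^ c) has_integral
           fact a * fact c / fact (a + c + 1) * t ^ (a + c + 1)) {0..t}"
proof (induction a arbitrary: c)
  case 0
  have "((\<lambda>x. - ((t - x) ^ Suc c) / real (Suc c)) has_real_derivative (t - x) ^ c) (at x within S)" for x S
    using DERIV_cdivide[OF DERIV_minus[OF has_real_derivative_power_diff[of t c x S]], of "real (Suc c)"] by simp
  hence "((\<lambda>x. (t - x) ^ c) has_integral
          (- ((t - t) ^ Suc c) / real (Suc c)) - (- ((t - 0) ^ Suc c) / real (Suc c))) {0..t}"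
    using assms
    by (intro fundamental_theorem_of_calculus)
       (simp_all only: has_real_derivative_iff_has_vector_derivative)
  moreover have "(- ((t - t) ^ Suc c) / real (Suc c)) - (- ((t - 0) ^ Suc c) / real (Suc c))
      = fact 0 * fact c / fact (0 + c + 1) * t ^ (0 + c + 1)"
    by (simp add: fact_Suc[of c] del: fact_Suc of_nat_Suc)
  ultimately show ?case by simp
next
  case (Suc a)
  let ?F = "\<lambda>x. - (x ^ Suc a * (t - x) ^ Suc c) / real (Suc c)"
  let ?q = "real (Suc a) / real (Suc c)"
  have "(?F has_real_derivative x ^ Suc a * (t - x) ^ c - ?q * (x ^ a * (t - x) ^ Suc c)) (at x within S)"
    for x S
  proof -
    have "((\<lambda>x. x ^ Suc a) has_real_derivative real (Suc a) * x ^ a) (at x within S)"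
      using DERIV_power[of "\<lambda>x. x" 1 x S "Suc a"] by simp
    from DERIV_cdivide[OF DERIV_minus[OF DERIV_mult[OF this has_real_derivative_power_diff[of t c x S]]], of "real (Suc c)"]
    show ?thesis
      by (rule DERIV_cong) (simp add: divide_simps del: of_nat_Suc power_Suc)
  qed
  hence "((\<lambda>x. x ^ Suc a * (t - x) ^ c - ?q * (x ^ a * (t - x) ^ Suc c)) has_integral (?F t - ?F 0)) {0..t}"
    using assms
    by (intro fundamental_theorem_of_calculus)
       (simp_all only: has_real_derivative_iff_has_vector_derivative)
  \<comment> \<open>Both exponents in \<open>?F\<close> are positive, so the boundary terms vanish
    at \<open>0\<close> and at \<open>t\<close>.\<close>
  hence "((\<lambda>x. x ^ Suc a * (t - x) ^ c - ?q * (x ^ a * (t - x) ^ Suc c)) has_integral 0) {0..t}"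
    by simp
  from has_integral_add[OF this has_integral_mult_right[OF Suc.IH[of "Suc c"], of ?q]]
  have "((\<lambda>x. x ^ Suc a * (t - x) ^ c) has_integral
      (?q * (fact a * fact (Suc c) / fact (a + Suc c + 1) * t ^ (a + Suc c + 1)))) {0..t}"
    by simp
  moreover have "?q * (fact a * fact (Suc c) / fact (a + Suc c + 1) * t ^ (a + Suc c + 1)) =
      fact (Suc a) * fact c / fact (Suc a + c + 1) * t ^ (Suc a + c + 1)"
    by (simp add: fact_Suc[of a] fact_Suc[of c] del: fact_Suc power_Suc of_nat_Suc)
  ultimately show ?case by (simp only:)
qed

text \<open>Fixing the last coordinate at \<open>y\<close> leaves a corner of size
  \<open>t - y\<close> in one dimension less, whence \<open>t\<close> is arbitrary in the induction;
  the outer integral is then a beta integral. For the nonnegative integral the iteration needs only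
  measurability, and the finite value yields integrability later.\<close>

lemma nn_integral_corner:
  fixes t :: real and a :: "nat \<Rightarrow> nat"
  assumes "0 \<le> t"
  shows "(\<integral>\<^sup>+x. ennreal (if (\<forall>i<m. 0 \<le> x i) \<and> (\<Sum>i<m. x i) \<le> t
             then (\<Prod>i<m. x i ^ a i) * (t - (\<Sum>i<m. x i)) ^ b else 0) \<partial>PiM {..<m} (\<lambda>_. lborel))
         = ennreal ((\<Prod>i<m. fact (a i)) * fact b / fact ((\<Sum>i<m. a i) + b + m) * t ^ ((\<Sum>i<m. a i) + b + m))"
  using assms
proof (induction m arbitrary: t)
  case 0
  thus ?case by (simp add: nn_integral_count_space_finite PiM_empty)
next
  case (Suc m)
  interpret product_sigma_finite "\<lambda>_::nat. lborel :: real measure" by standard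
  define N where "N = (\<Sum>i<m. a i) + b + m"
  define C :: real where "C = (\<Prod>i<m. fact (a i)) * fact b / fact N"
  define f :: "nat \<Rightarrow> real \<Rightarrow> (nat \<Rightarrow> real) \<Rightarrow> real" where
    "f = (\<lambda>m t x. if (\<forall>i<m. 0 \<le> x i) \<and> (\<Sum>i<m. x i) \<le> t
             then (\<Prod>i<m. x i ^ a i) * (t - (\<Sum>i<m. x i)) ^ b else 0)"
  have meas: "f m t \<in> borel_measurable (PiM {..<m} (\<lambda>_. lborel))" for m t
  proof -
    have [measurable]: "Measurable.pred (PiM {..<m} (\<lambda>_. lborel)) (\<lambda>x. \<forall>i\<in>{..<m}. (0::real) \<le> x i)"
      by measurable
    thus ?thesis
      unfolding f_def Ball_def lessThan_iff by measurable
  qed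
  have "(\<integral>\<^sup>+x. ennreal (f (Suc m) t x) \<partial>PiM {..<Suc m} (\<lambda>_. lborel))
      = (\<integral>\<^sup>+y. \<integral>\<^sup>+x. ennreal (f (Suc m) t (x(m := y))) \<partial>PiM {..<m} (\<lambda>_. lborel) \<partial>lborel)"
    unfolding lessThan_Suc
    by (rule product_nn_integral_insert_rev) (use meas[of "Suc m" t] in \<open>simp_all add: lessThan_Suc\<close>)
  also have "\<dots> = (\<integral>\<^sup>+y. ennreal (C * (y ^ a m * (t - y) ^ N)) * indicator {0..t} y \<partial>lborel)"
  proof (intro nn_integral_cong)
    fix y :: real
    show "(\<integral>\<^sup>+x. ennreal (f (Suc m) t (x(m := y))) \<partial>PiM {..<m} (\<lambda>_. lborel))
       = ennreal (C * (y ^ a m * (t - y) ^ N)) * indicator {0..t} y"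
    proof (cases "y \<in> {0..t}")
      case True
      \<comment> \<open>The slack \<open>t - (\<Sum>i<Suc m. x i)\<close> of the corner equals the
        slack of its slice of size \<open>t - y\<close>.\<close>
      have eq: "f (Suc m) t (x(m := y)) = y ^ a m * f m (t - y) x" for x
        using True by (auto simp: f_def less_Suc_eq algebra_simps)
      have "(\<integral>\<^sup>+x. ennreal (f (Suc m) t (x(m := y))) \<partial>PiM {..<m} (\<lambda>_. lborel))
          = ennreal (y ^ a m) * (\<integral>\<^sup>+x. ennreal (f m (t - y) x) \<partial>PiM {..<m} (\<lambda>_. lborel))"
        unfolding eq using True meas[of m "t - y"]
        by (subst nn_integral_cmult[symmetric]) (auto simp: ennreal_mult' intro!: nn_integral_cong)
      also have "\<dots> = ennreal (y ^ a m) * ennreal (C * (t - y) ^ N)"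
        using Suc.IH[of "t - y"] True by (simp add: C_def N_def f_def)
      finally show ?thesis
        using True by (simp add: ennreal_mult'[symmetric] mult_ac)
    next
      case False
      have "f (Suc m) t (x(m := y)) = 0" for x
        unfolding f_def
      proof (rule if_not_P, rule notI)
        assume *: "(\<forall>i<Suc m. 0 \<le> (x(m := y)) i) \<and> (\<Sum>i<Suc m. (x(m := y)) i) \<le> t"
        hence "0 \<le> (\<Sum>i<m. x i)" by (intro sum_nonneg) (auto simp: less_Suc_eq)
        moreover have "0 \<le> y" using * by auto
        moreover have "(\<Sum>i<m. x i) + y \<le> t" using * by simp
        ultimately show False using False by auto
      qed
      thus ?thesis using False by simp
    qed
  qed
  also have "\<dots> = ennreal (C * (fact (a m) * fact N / fact (a m + N + 1) * t ^ (a m + N + 1)))"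
  proof (rule nn_integral_has_integral_lebesgue')
    show "0 \<le> C * (y ^ a m * (t - y) ^ N)" if "y \<in> {0..t}" for y
    proof -
      have "0 \<le> C" by (auto simp: C_def intro!: divide_nonneg_nonneg mult_nonneg_nonneg prod_nonneg)
      thus ?thesis using that by simp
    qed
  qed (intro has_integral_mult_right has_integral_power_times_power Suc.prems)
  also have "C * (fact (a m) * fact N / fact (a m + N + 1) * t ^ (a m + N + 1))
     = (\<Prod>i<Suc m. fact (a i)) * fact b / fact ((\<Sum>i<Suc m. a i) + b + Suc m) * t ^ ((\<Sum>i<Suc m. a i) + b + Suc m)"
  proof -
    have e: "(\<Sum>i<Suc m. a i) + b + Suc m = a m + N + 1" by (simp add: N_def)
    show ?thesis unfolding e by (simp add: C_def del: fact_Suc power_Suc)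
  qed
  finally show ?case by (simp only: f_def)
qed

text \<open>In the free coordinates the simplex is the corner of size 1, with the slack as last
  coordinate. Membership of \<open>x\<close> in the product space supplies the extensionality that
  \<open>simplex_vec\<close> demands.\<close>

lemma complete_vec_in_simplex_iff:
  assumes "x \<in> space (PiM {..<n - 1} (\<lambda>_. lborel :: real measure))" "n \<ge> 1"
  shows "complete_vec n x \<in> simplex_vec n \<longleftrightarrow>
           (\<forall>i<n - 1. 0 \<le> x i) \<and> (\<Sum>i<n - 1. x i) \<le> 1"
proof -
  obtain m where n: "n = Suc m" using assms(2) by (cases n) auto
  show ?thesis
    using assms(1) unfolding n
    by (auto simp: complete_vec_def simplex_vec_def space_PiM PiE_iff extensional_def less_Suc_eq)
qed

text \<open>Couples the value with integrability: \<open>simplex_integral\<close> alone is 0 on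
  non-integrable functions, so it is not linear without side conditions.\<close>

definition simplex_has_integral :: "nat \<Rightarrow> ((nat \<Rightarrow> real) \<Rightarrow> real) \<Rightarrow> real \<Rightarrow> bool" where
  "simplex_has_integral n f I \<longleftrightarrow>
     has_bochner_integral (PiM {..<n - 1} (\<lambda>_. lborel))
       (\<lambda>x. indicator {x. complete_vec n x \<in> simplex_vec n} x *\<^sub>R f (complete_vec n x)) I"

lemma simplex_integral_eq: "simplex_has_integral n f I \<Longrightarrow> simplex_integral n f = I"
  unfolding simplex_has_integral_def simplex_integral_def set_lebesgue_integral_def
  by (rule has_bochner_integral_integral_eq)

lemma simplex_has_integral_sum:
  assumes "\<And>y. y \<in> A \<Longrightarrow> simplex_has_integral n (f y) (I y)"
  shows "simplex_has_integral n (\<lambda>r. \<Sum>y\<in>A. c y * f y r) (\<Sum>y\<in>A. c y * I y)"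
proof -
  have "has_bochner_integral (PiM {..<n - 1} (\<lambda>_. lborel))
      (\<lambda>x. \<Sum>y\<in>A. c y * (indicator {x. complete_vec n x \<in> simplex_vec n} x *\<^sub>R f y (complete_vec n x)))
      (\<Sum>y\<in>A. c y * I y)"
    using assms unfolding simplex_has_integral_def
    by (intro has_bochner_integral_sum has_bochner_integral_mult_right) auto
  thus ?thesis
    unfolding simplex_has_integral_def by (simp add: sum_distrib_left mult_ac)
qed

lemma simplex_has_integral_cmult:
  "simplex_has_integral n f I \<Longrightarrow> simplex_has_integral n (\<lambda>r. c * f r) (c * I)"
  using simplex_has_integral_sum[of "{()}" n "\<lambda>_. f" "\<lambda>_. I" "\<lambda>_. c"] by simp

lemma simplex_has_integral_cong:
  assumes "\<And>r. r \<in> simplex_vec n \<Longrightarrow> f r = g r"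
  shows "simplex_has_integral n f I \<longleftrightarrow> simplex_has_integral n g I"
  unfolding simplex_has_integral_def
  by (intro has_bochner_integral_cong) (auto simp: indicator_def assms)

text \<open>The corner integral in \<open>n - 1\<close> variables at \<open>t = 1\<close>, where the
  slack exponent is that of the last coordinate.\<close>

lemma dirichlet_integral:
  assumes "n \<ge> 1"
  shows "simplex_has_integral n (\<lambda>r. \<Prod>i<n. r i ^ a i)
           ((\<Prod>i<n. fact (a i)) / fact ((\<Sum>i<n. a i) + n - 1))"
proof -
  obtain m where n: "n = Suc m" using assms by (cases n) auto
  let ?f = "\<lambda>x. (if (\<forall>i<m. 0 \<le> x i) \<and> (\<Sum>i<m. x i) \<le> 1
             then (\<Prod>i<m. x i ^ a i) * (1 - (\<Sum>i<m. x i)) ^ a m else 0) :: real"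
  let ?M = "PiM {..<m} (\<lambda>_. lborel) :: (nat \<Rightarrow> real) measure"
  have [measurable]: "Measurable.pred ?M (\<lambda>x. \<forall>i\<in>{..<m}. (0::real) \<le> x i)"
    by measurable
  hence [measurable]: "?f \<in> borel_measurable ?M"
    unfolding Ball_def lessThan_iff by measurable
  have "has_bochner_integral ?M ?f ((\<Prod>i<n. fact (a i)) / fact ((\<Sum>i<n. a i) + n - 1))"
    by (rule has_bochner_integral_nn_integral)
       (use nn_integral_corner[of 1 m a "a m"] in
        \<open>auto simp: n intro!: divide_nonneg_nonneg mult_nonneg_nonneg prod_nonneg\<close>)
  also have "?this \<longleftrightarrow> ?thesis"
    unfolding simplex_has_integral_def n diff_Suc_1
  proof (intro has_bochner_integral_cong refl)
    fix x assume "x \<in> space ?M"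
    thus "?f x = indicator {x. complete_vec (Suc m) x \<in> simplex_vec (Suc m)} x *\<^sub>R
            (\<Prod>i<Suc m. complete_vec (Suc m) x i ^ a i)"
      using complete_vec_in_simplex_iff[of x "Suc m"] by (auto simp: complete_vec_def)
  qed
  finally show ?thesis .
qed

section \<open>The Gram matrix of the multinomials and its definiteness\<close>

lemma size_eq_sum_count:
  assumes "\<phi> \<in> multisets_on n"
  shows "size \<phi> = (\<Sum>i<n. count \<phi> i)"
  unfolding size_multiset_overloaded_eq
  using assms by (intro sum.mono_neutral_left) (auto simp: multisets_on_def not_in_iff)

lemma multisets_of_size_iff: "\<phi> \<in> multisets_on_of_size n K \<longleftrightarrow> \<phi> \<in> multisets_on n \<and> size \<phi> = K"
  by (simp add: multisets_of_size_def multisets_on_def)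

text \<open>On the simplex the product is a multiple of a single monomial. The sizes of \<phi> and
  \<psi> may differ, which later allows pairing across degrees.\<close>

lemma simplex_has_integral_multinomial_mult:
  assumes "n \<ge> 1" "\<phi> \<in> multisets_on n" "\<psi> \<in> multisets_on n"
  shows "simplex_has_integral n (\<lambda>r. multinomial_fun n \<phi> r * multinomial_fun n \<psi> r)
    (fact (size \<phi>) / (\<Prod>i<n. fact (count \<phi> i)) * (fact (size \<psi>) / (\<Prod>i<n. fact (count \<psi> i))) *
      ((\<Prod>i<n. fact (count \<phi> i + count \<psi> i)) / fact (size \<phi> + size \<psi> + n - 1)))"
    (is "simplex_has_integral n ?f (?c * ?I)")
proof -
  have "simplex_has_integral n (\<lambda>r. ?c * (\<Prod>i<n. r i ^ (count \<phi> i + count \<psi> i))) (?c * ?I)"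
    using dirichlet_integral[OF assms(1), of "\<lambda>i. count \<phi> i + count \<psi> i"]
    by (intro simplex_has_integral_cmult)
       (simp add: sum.distrib size_eq_sum_count[OF assms(2)] size_eq_sum_count[OF assms(3)])
  also have "?this \<longleftrightarrow> ?thesis"
    by (intro simplex_has_integral_cong) (simp add: multinomial_fun_def power_add prod.distrib)
  finally show ?thesis .
qed

lemmas multinomial_inner =
  simplex_has_integral_multinomial_mult[THEN simplex_integral_eq, folded simplex_inner_def]

lemma simplex_has_integral_multinomial_inner:
  assumes "n \<ge> 1" "\<phi> \<in> multisets_on n" "\<psi> \<in> multisets_on n"
  shows "simplex_has_integral n (\<lambda>r. multinomial_fun n \<phi> r * multinomial_fun n \<psi> r)
           (simplex_inner n (multinomial_fun n \<phi>) (multinomial_fun n \<psi>))"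
  unfolding multinomial_inner[OF assms] by (rule simplex_has_integral_multinomial_mult[OF assms])

text \<open>Vandermonde's convolution for \<open>(p + q) choose q\<close>. Terms with
  \<open>k > q\<close> vanish, so a common bound \<open>N\<close> can serve all coordinates when a
  product of such sums is expanded.\<close>

lemma fact_add_eq_sum_binomial:
  assumes "q \<le> N"
  shows "(fact (p + q) :: real) = fact p * fact q * (\<Sum>k\<le>N. real (p choose k) * real (q choose k))"
proof -
  have "(p + q) choose q = (\<Sum>k\<le>q. (p choose k) * (q choose (q - k)))"
    by (rule vandermonde[symmetric])
  also have "\<dots> = (\<Sum>k\<le>q. (p choose k) * (q choose k))"
    by (intro sum.cong) (auto simp: binomial_symmetric[symmetric])
  also have "\<dots> = (\<Sum>k\<le>N. (p choose k) * (q choose k))"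
    using assms by (intro sum.mono_neutral_left) auto
  finally have "real ((p + q) choose q) = (\<Sum>k\<le>N. real (p choose k) * real (q choose k))"
    by simp
  moreover have "real ((p + q) choose q) = fact (p + q) / (fact q * fact p)"
    by (subst binomial_fact) auto
  ultimately show ?thesis by (simp add: field_simps)
qed

text \<open>The factorials of the multiplicities cancel against the multinomial coefficients. What
  remains is a positive constant times a matrix multiplied by its own transpose, with inner index
  \<kappa>.\<close>

lemma multinomial_inner_eq_sum_binomials:
  assumes "n \<ge> 1" "\<phi> \<in> multisets_on_of_size n K" "\<psi> \<in> multisets_on_of_size n K"
  shows "simplex_inner n (multinomial_fun n \<phi>) (multinomial_fun n \<psi>) =
    fact K * fact K / fact (K + K + n - 1) *
    (\<Sum>\<kappa>\<in>{..<n} \<rightarrow>\<^sub>E {..K}. (\<Prod>i<n. real (count \<phi> i choose \<kappa> i)) * (\<Prod>i<n. real (count \<psi> i choose \<kappa> i)))"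
proof -
  have "(\<Prod>i<n. fact (count \<phi> i + count \<psi> i) :: real) =
     (\<Prod>i<n. fact (count \<phi> i) * fact (count \<psi> i) *
        (\<Sum>k\<le>K. real (count \<phi> i choose k) * real (count \<psi> i choose k)))"
    using assms count_le_size[of \<psi>]
    by (intro prod.cong refl fact_add_eq_sum_binomial) (simp add: multisets_of_size_def)
  also have "\<dots> = (\<Prod>i<n. fact (count \<phi> i)) * (\<Prod>i<n. fact (count \<psi> i)) *
     (\<Sum>\<kappa>\<in>{..<n} \<rightarrow>\<^sub>E {..K}. (\<Prod>i<n. real (count \<phi> i choose \<kappa> i)) * (\<Prod>i<n. real (count \<psi> i choose \<kappa> i)))"
    by (simp add: prod.distrib prod_sum_PiE)
  finally show ?thesis
    using assms by (simp add: multinomial_inner multisets_of_size_iff)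
qed

text \<open>
  The factorisation of the Gram matrix through products of binomial coefficients makes its
  quadratic form a sum of squares, one of which is the square of \<open>a \<xi>\<close> for each \<open>\<xi>\<close>:
  among multisets of the same size only \<open>\<xi>\<close> itself dominates \<open>\<xi>\<close>.
\<close>

lemma multinomial_gram_definite:
  assumes "n \<ge> 1"
    and zero: "(\<Sum>\<phi>\<in>multisets_on_of_size n K. \<Sum>\<psi>\<in>multisets_on_of_size n K.
      a \<phi> * a \<psi> * simplex_inner n (multinomial_fun n \<phi>) (multinomial_fun n \<psi>)) = 0"
    and \<xi>: "\<xi> \<in> multisets_on_of_size n K"
  shows "a \<xi> = 0"
proof -
  let ?M = "multisets_on_of_size n K"
  let ?P = "{..<n} \<rightarrow>\<^sub>E {..K}"
  define B where "B = (\<lambda>\<phi> \<kappa>. \<Prod>i<n. real (count \<phi> i choose \<kappa> i))"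
  define C :: real where "C = fact K * fact K / fact (K + K + n - 1)"
  have fin: "finite ?P" by (intro finite_PiE) auto
  have "(\<Sum>\<phi>\<in>?M. \<Sum>\<psi>\<in>?M. a \<phi> * a \<psi> * simplex_inner n (multinomial_fun n \<phi>) (multinomial_fun n \<psi>))
    = (\<Sum>\<phi>\<in>?M. \<Sum>\<psi>\<in>?M. \<Sum>\<kappa>\<in>?P. C * ((a \<phi> * B \<phi> \<kappa>) * (a \<psi> * B \<psi> \<kappa>)))"
    using assms(1)
    by (intro sum.cong refl)
       (simp add: multinomial_inner_eq_sum_binomials B_def C_def sum_distrib_left mult_ac)
  also have "\<dots> = (\<Sum>\<kappa>\<in>?P. \<Sum>\<phi>\<in>?M. \<Sum>\<psi>\<in>?M. C * ((a \<phi> * B \<phi> \<kappa>) * (a \<psi> * B \<psi> \<kappa>)))"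
    by (simp add: sum.swap[of _ ?P])
  also have "\<dots> = C * (\<Sum>\<kappa>\<in>?P. (\<Sum>\<phi>\<in>?M. a \<phi> * B \<phi> \<kappa>)\<^sup>2)"
    by (simp only: power2_eq_square sum_product, simp only: sum_distrib_left)
  finally have "C * (\<Sum>\<kappa>\<in>?P. (\<Sum>\<phi>\<in>?M. a \<phi> * B \<phi> \<kappa>)\<^sup>2) = 0"
    using zero by simp
  hence "(\<Sum>\<kappa>\<in>?P. (\<Sum>\<phi>\<in>?M. a \<phi> * B \<phi> \<kappa>)\<^sup>2) = 0"
    by (simp add: C_def)
  hence sq: "(\<Sum>\<phi>\<in>?M. a \<phi> * B \<phi> \<kappa>) = 0" if "\<kappa> \<in> ?P" for \<kappa>
    using that fin by (subst (asm) sum_nonneg_eq_0_iff) auto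
  define \<kappa> where "\<kappa> = restrict (count \<xi>) {..<n}"
  have "\<kappa> \<in> ?P"
    using \<xi> count_le_size[of \<xi>] by (auto simp: \<kappa>_def multisets_of_size_def)
  have B\<xi>: "B \<xi> \<kappa> = 1" by (simp add: B_def \<kappa>_def)
  have "B \<phi> \<kappa> = 0" if "\<phi> \<in> ?M" "\<phi> \<noteq> \<xi>" for \<phi>
  proof (rule ccontr)
    assume "B \<phi> \<kappa> \<noteq> 0"
    hence le: "count \<xi> i \<le> count \<phi> i" if "i < n" for i
      using that by (auto simp: B_def \<kappa>_def not_less)
    have "\<xi> \<subseteq># \<phi>"
    proof (rule mset_subset_eqI)
      fix i show "count \<xi> i \<le> count \<phi> i"
      proof (cases "i < n")
        case False
        hence "i \<notin># \<xi>" using \<xi> by (auto simp: multisets_of_size_def)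
        thus ?thesis by (simp add: not_in_iff)
      qed (rule le)
    qed
    moreover have "size \<phi> = size \<xi>" using that(1) \<xi> by (simp add: multisets_of_size_def)
    ultimately show False
      using that(2) mset_subset_size[of \<xi> \<phi>] by (auto simp: subset_mset.less_le)
  qed
  hence "(\<Sum>\<phi>\<in>?M. a \<phi> * B \<phi> \<kappa>) = (\<Sum>\<phi>\<in>{\<xi>}. a \<phi> * B \<phi> \<kappa>)"
    using \<xi> by (intro sum.mono_neutral_right) (auto intro!: finite_multisets_of_size)
  thus ?thesis using sq[OF \<open>\<kappa> \<in> ?P\<close>] B\<xi> by simp
qed

text \<open>The induction step is Schur complementation: \<open>p\<close> is the Schur complement of \<open>G\<close> on \<open>M\<close>.\<close>

lemma definite_linear_system_solvable:
  fixes G :: "'a \<Rightarrow> 'a \<Rightarrow> real"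
  assumes "finite M"
    and "\<And>a. (\<Sum>\<phi>\<in>M. \<Sum>\<psi>\<in>M. a \<phi> * a \<psi> * G \<phi> \<psi>) = 0 \<Longrightarrow> \<forall>\<phi>\<in>M. a \<phi> = 0"
  shows "\<exists>a. \<forall>\<xi>\<in>M. (\<Sum>\<phi>\<in>M. a \<phi> * G \<xi> \<phi>) = b \<xi>"
  using assms
proof (induction M arbitrary: b)
  case empty
  show ?case by simp
next
  case (insert x M)
  have split: "(\<Sum>\<phi>\<in>insert x M. (f(x := s)) \<phi> * G \<xi> \<phi>) = s * G \<xi> x + (\<Sum>\<phi>\<in>M. f \<phi> * G \<xi> \<phi>)" for f s \<xi>
    using insert.hyps by (auto intro!: sum.cong)
  have definite: "\<forall>\<phi>\<in>M. a \<phi> = 0" if "(\<Sum>\<phi>\<in>M. \<Sum>\<psi>\<in>M. a \<phi> * a \<psi> * G \<phi> \<psi>) = 0" for a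
  proof -
    have "(\<Sum>\<phi>\<in>insert x M. \<Sum>\<psi>\<in>insert x M. (a(x := 0)) \<phi> * (a(x := 0)) \<psi> * G \<phi> \<psi>)
        = (\<Sum>\<phi>\<in>M. \<Sum>\<psi>\<in>M. a \<phi> * a \<psi> * G \<phi> \<psi>)"
      using insert.hyps by (auto intro!: sum.cong)
    hence "\<forall>\<phi>\<in>insert x M. (a(x := 0)) \<phi> = 0"
      using that by (intro insert.prems) simp
    thus ?thesis using insert.hyps by (metis fun_upd_other insertCI)
  qed
  \<comment> \<open>\<open>u\<close> reproduces the column of \<open>x\<close> on the rows in
    \<open>M\<close>, while \<open>v\<close> solves the given system on these rows without the
    unknown at \<open>x\<close>.\<close>
  obtain u where u: "\<And>\<xi>. \<xi> \<in> M \<Longrightarrow> (\<Sum>\<phi>\<in>M. u \<phi> * G \<xi> \<phi>) = G \<xi> x"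
    using insert.IH[of "\<lambda>\<xi>. G \<xi> x", OF definite] by blast
  obtain v where v: "\<And>\<xi>. \<xi> \<in> M \<Longrightarrow> (\<Sum>\<phi>\<in>M. v \<phi> * G \<xi> \<phi>) = b \<xi>"
    using insert.IH[of b, OF definite] by blast
  define p where "p = G x x - (\<Sum>\<phi>\<in>M. u \<phi> * G x \<phi>)"
  have "p \<noteq> 0"
  proof
    assume "p = 0"
    \<comment> \<open>If \<open>p = 0\<close>, every row annihilates \<open>w\<close>, so its
      quadratic form vanishes although \<open>w x = 1\<close>.\<close>
    define w where "w = (\<lambda>\<phi>. - u \<phi>)(x := 1)"
    have "(\<Sum>\<psi>\<in>insert x M. w \<psi> * G \<phi> \<psi>) = 0" if "\<phi> \<in> insert x M" for \<phi>
      using that u \<open>p = 0\<close> unfolding w_def split by (auto simp: p_def sum_negf)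
    hence "(\<Sum>\<phi>\<in>insert x M. w \<phi> * (\<Sum>\<psi>\<in>insert x M. w \<psi> * G \<phi> \<psi>)) = 0"
      by (intro sum.neutral) simp
    hence "(\<Sum>\<phi>\<in>insert x M. \<Sum>\<psi>\<in>insert x M. w \<phi> * w \<psi> * G \<phi> \<psi>) = 0"
      by (simp only: sum_distrib_left mult.assoc)
    from insert.prems[OF this] show False by (simp add: w_def)
  qed
  \<comment> \<open>The vector \<open>v - s * u\<close> with entry \<open>s\<close> at
    \<open>x\<close> satisfies the rows in \<open>M\<close> for any \<open>s\<close>; row
    \<open>x\<close> then determines \<open>s\<close>.\<close>
  define s where "s = (b x - (\<Sum>\<phi>\<in>M. v \<phi> * G x \<phi>)) / p"
  have "(\<Sum>\<phi>\<in>insert x M. ((\<lambda>\<phi>. v \<phi> - s * u \<phi>)(x := s)) \<phi> * G \<xi> \<phi>) = b \<xi>" if "\<xi> \<in> insert x M" for \<xi>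
  proof -
    have "(\<Sum>\<phi>\<in>insert x M. ((\<lambda>\<phi>. v \<phi> - s * u \<phi>)(x := s)) \<phi> * G \<xi> \<phi>)
        = (\<Sum>\<phi>\<in>M. v \<phi> * G \<xi> \<phi>) + s * (G \<xi> x - (\<Sum>\<phi>\<in>M. u \<phi> * G \<xi> \<phi>))"
      unfolding split by (simp add: algebra_simps sum_subtractf sum_distrib_left)
    also have "\<dots> = b \<xi>"
    proof (cases "\<xi> = x")
      case True
      have "s * p = b x - (\<Sum>\<phi>\<in>M. v \<phi> * G x \<phi>)" using \<open>p \<noteq> 0\<close> by (simp add: s_def)
      thus ?thesis unfolding True p_def by simp
    next
      case False
      thus ?thesis using that u v by simp
    qed
    finally show ?thesis .
  qed
  thus ?case by blast
qed

section \<open>The dual multinomials\<close>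

lemma finite_multisets_on_of_size: "finite (multisets_on_of_size n K)"
  by (rule finite_multisets_of_size) simp

lemma sum_fun_apply: "(\<Sum>y\<in>A. f y) r = (\<Sum>y\<in>A. f y r)"
  by (induction A rule: infinite_finite_induct) auto

text \<open>Replaces the abstract span by coefficient families, on which the Gram matrix acts. The
  range is a subspace containing the generators, and conversely each of its members is a finite
  combination of them.\<close>

lemma simplex_polys_eq_range:
  "simplex_polys n K = range (\<lambda>a r. \<Sum>\<phi>\<in>multisets_on_of_size n K. a \<phi> * multinomial_fun n \<phi> r)"
    (is "_ = range ?poly")
proof
  let ?M = "multisets_on_of_size n K"
  have "fun_space.subspace (range ?poly)"
    unfolding fun_space.subspace_def
  proof (intro conjI ballI allI)
    have "0 = ?poly (\<lambda>_. 0)" by (simp add: fun_eq_iff)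
    thus "0 \<in> range ?poly" by (rule range_eqI[of _ ?poly "\<lambda>_. 0"])
  next
    fix f g assume "f \<in> range ?poly" "g \<in> range ?poly"
    then obtain a b where "f = ?poly a" "g = ?poly b" by blast
    hence "f + g = ?poly (\<lambda>\<phi>. a \<phi> + b \<phi>)"
      by (simp add: fun_eq_iff algebra_simps sum.distrib)
    thus "f + g \<in> range ?poly" by (rule range_eqI[of _ ?poly "\<lambda>\<phi>. a \<phi> + b \<phi>"])
  next
    fix c f assume "f \<in> range ?poly"
    then obtain a where "f = ?poly a" by blast
    hence "(\<lambda>r. c * f r) = ?poly (\<lambda>\<phi>. c * a \<phi>)"
      by (simp add: fun_eq_iff sum_distrib_left algebra_simps)
    thus "(\<lambda>r. c * f r) \<in> range ?poly" by (rule range_eqI[of _ ?poly "\<lambda>\<phi>. c * a \<phi>"])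
  qed
  moreover have "multinomial_fun n ` ?M \<subseteq> range ?poly"
  proof safe
    fix \<psi> assume "\<psi> \<in> ?M"
    hence "multinomial_fun n \<psi> = ?poly (\<lambda>\<phi>. if \<phi> = \<psi> then 1 else 0)"
      by (simp add: finite_multisets_on_of_size if_distrib[of "\<lambda>x. x * _"] cong: if_cong)
    thus "multinomial_fun n \<psi> \<in> range ?poly"
      by (rule range_eqI[of _ ?poly "\<lambda>\<phi>. if \<phi> = \<psi> then 1 else 0"])
  qed
  ultimately show "simplex_polys n K \<subseteq> range ?poly"
    unfolding simplex_polys_def by (intro fun_space.span_minimal)
next
  show "range ?poly \<subseteq> simplex_polys n K"
  proof safe
    fix a :: "nat multiset \<Rightarrow> real"
    have "?poly a = (\<Sum>\<phi>\<in>multisets_on_of_size n K. (\<lambda>r. a \<phi> * multinomial_fun n \<phi> r))"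
      by (auto simp: fun_eq_iff sum_fun_apply)
    also have "\<dots> \<in> simplex_polys n K"
      unfolding simplex_polys_def
      by (intro fun_space.span_sum fun_space.span_scale fun_space.span_base imageI)
    finally show "?poly a \<in> simplex_polys n K" .
  qed
qed

lemma simplex_polys_iff:
  "f \<in> simplex_polys n K \<longleftrightarrow>
     (\<exists>a. f = (\<lambda>r. \<Sum>\<phi>\<in>multisets_on_of_size n K. a \<phi> * multinomial_fun n \<phi> r))"
  by (auto simp: simplex_polys_eq_range)

text \<open>Bilinearity for combinations of multinomials, where integrability is known.
  \<open>A\<close> and \<open>B\<close> may contain multisets of different sizes.\<close>

lemma simplex_inner_sums:
  assumes "n \<ge> 1" "A \<subseteq> multisets_on n" "B \<subseteq> multisets_on n"
  shows "simplex_inner n (\<lambda>r. \<Sum>\<phi>\<in>A. a \<phi> * multinomial_fun n \<phi> r) (\<lambda>r. \<Sum>\<psi>\<in>B. b \<psi> * multinomial_fun n \<psi> r)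
       = (\<Sum>\<phi>\<in>A. a \<phi> * (\<Sum>\<psi>\<in>B. b \<psi> * simplex_inner n (multinomial_fun n \<phi>) (multinomial_fun n \<psi>)))"
proof -
  have "simplex_has_integral n
      (\<lambda>r. \<Sum>\<phi>\<in>A. a \<phi> * (\<Sum>\<psi>\<in>B. b \<psi> * (multinomial_fun n \<phi> r * multinomial_fun n \<psi> r)))
      (\<Sum>\<phi>\<in>A. a \<phi> * (\<Sum>\<psi>\<in>B. b \<psi> * simplex_inner n (multinomial_fun n \<phi>) (multinomial_fun n \<psi>)))"
    using assms
    by (intro simplex_has_integral_sum simplex_has_integral_multinomial_inner) auto
  from simplex_integral_eq[OF this] show ?thesis
    unfolding simplex_inner_def
    by (simp only: sum_product) (simp only: sum_distrib_left mult_ac)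
qed

text \<open>Justifies the definite description. Existence solves the Gram system for a unit vector;
  for uniqueness, the difference of two coefficient families has vanishing quadratic form.\<close>

lemma dual_multinomial:
  assumes "n \<ge> 1" "\<psi> \<in> multisets_on n"
  shows "dual_multinomial n \<psi> \<in> simplex_polys n (size \<psi>)"
    and "\<phi> \<in> multisets_on_of_size n (size \<psi>) \<Longrightarrow>
      simplex_inner n (multinomial_fun n \<phi>) (dual_multinomial n \<psi>) = (if \<phi> = \<psi> then 1 else 0)"
proof -
  define K where "K = size \<psi>"
  let ?M = "multisets_on_of_size n K"
  let ?m = "multinomial_fun n"
  let ?poly = "\<lambda>a r. \<Sum>\<phi>\<in>?M. a \<phi> * ?m \<phi> r"
  let ?P = "\<lambda>d. d \<in> simplex_polys n K \<and>
       (\<forall>\<phi>\<in>?M. simplex_inner n (?m \<phi>) d = (if \<phi> = \<psi> then 1 else 0))"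
  have inner: "simplex_inner n (?m \<phi>) (?poly a) = (\<Sum>\<psi>\<in>?M. a \<psi> * simplex_inner n (?m \<phi>) (?m \<psi>))"
    if "\<phi> \<in> ?M" for \<phi> a
    using simplex_inner_sums[of n "{\<phi>}" ?M "\<lambda>_. 1" a] that assms(1)
    by (auto simp: multisets_of_size_def multisets_on_def)
  have definite: "\<forall>\<phi>\<in>?M. a \<phi> = 0"
    if "(\<Sum>\<phi>\<in>?M. \<Sum>\<psi>\<in>?M. a \<phi> * a \<psi> * simplex_inner n (?m \<phi>) (?m \<psi>)) = 0" for a
    using multinomial_gram_definite[OF assms(1) that] by blast
  have "\<exists>a. \<forall>\<phi>\<in>?M. (\<Sum>\<psi>\<in>?M. a \<psi> * simplex_inner n (?m \<phi>) (?m \<psi>)) = (if \<phi> = \<psi> then 1 else 0)"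
    by (rule definite_linear_system_solvable[OF finite_multisets_on_of_size]) (rule definite)
  then obtain a where
    a: "\<forall>\<phi>\<in>?M. (\<Sum>\<psi>\<in>?M. a \<psi> * simplex_inner n (?m \<phi>) (?m \<psi>)) = (if \<phi> = \<psi> then 1 else 0)" ..
  have "\<exists>!d. ?P d"
  proof (rule ex1I[of _ "?poly a"])
    show "?P (?poly a)" using a by (auto simp: simplex_polys_iff inner)
  next
    fix d assume d: "?P d"
    then obtain b where b: "d = ?poly b" by (auto simp: simplex_polys_iff)
    have "(\<Sum>\<psi>\<in>?M. (b \<psi> - a \<psi>) * simplex_inner n (?m \<phi>) (?m \<psi>)) = 0" if "\<phi> \<in> ?M" for \<phi>
      using that d inner[OF that, of b] a
      by (simp add: b left_diff_distrib sum_subtractf)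
    hence "(\<Sum>\<phi>\<in>?M. (b \<phi> - a \<phi>) * (\<Sum>\<psi>\<in>?M. (b \<psi> - a \<psi>) * simplex_inner n (?m \<phi>) (?m \<psi>))) = 0"
      by simp
    hence "\<forall>\<phi>\<in>?M. b \<phi> - a \<phi> = 0"
      by (intro definite) (simp only: sum_distrib_left mult.assoc)
    thus "d = ?poly a" unfolding b by (intro ext sum.cong) auto
  qed
  from theI'[OF this] show "dual_multinomial n \<psi> \<in> simplex_polys n (size \<psi>)"
    and "\<phi> \<in> multisets_on_of_size n (size \<psi>) \<Longrightarrow>
      simplex_inner n (multinomial_fun n \<phi>) (dual_multinomial n \<psi>) = (if \<phi> = \<psi> then 1 else 0)"
    unfolding dual_multinomial_def K_def by auto
qed

text \<open>The dual multinomial is itself a combination of multinomials, so this is an instance of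
  bilinearity.\<close>

lemma simplex_inner_sum_dual:
  assumes "n \<ge> 1" "A \<subseteq> multisets_on n" "\<upsilon> \<in> multisets_on n"
  shows "simplex_inner n (\<lambda>r. \<Sum>\<phi>\<in>A. a \<phi> * multinomial_fun n \<phi> r) (dual_multinomial n \<upsilon>)
       = (\<Sum>\<phi>\<in>A. a \<phi> * simplex_inner n (multinomial_fun n \<phi>) (dual_multinomial n \<upsilon>))"
proof -
  let ?M = "multisets_on_of_size n (size \<upsilon>)"
  obtain b where b: "dual_multinomial n \<upsilon> = (\<lambda>r. \<Sum>\<psi>\<in>?M. b \<psi> * multinomial_fun n \<psi> r)"
    using dual_multinomial(1)[OF assms(1,3)] by (auto simp: simplex_polys_iff)
  have M: "?M \<subseteq> multisets_on n" by (auto simp: multisets_of_size_iff)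
  have "simplex_inner n (multinomial_fun n \<phi>) (dual_multinomial n \<upsilon>) =
     (\<Sum>\<psi>\<in>?M. b \<psi> * simplex_inner n (multinomial_fun n \<phi>) (multinomial_fun n \<psi>))" if "\<phi> \<in> A" for \<phi>
    using simplex_inner_sums[OF assms(1) _ M, of "{\<phi>}" "\<lambda>_. 1" b] that assms(2) by (auto simp: b)
  thus ?thesis using simplex_inner_sums[OF assms(1,2) M, of a b] by (simp add: b)
qed

text \<open>Biorthogonality removes every term except that of \<upsilon>. This is the tool for
  comparing coefficients, in place of linear independence.\<close>

lemma simplex_inner_dual_coeff:
  assumes "n \<ge> 1" "\<upsilon> \<in> multisets_on_of_size n K"
  shows "simplex_inner n (\<lambda>r. \<Sum>\<phi>\<in>multisets_on_of_size n K. a \<phi> * multinomial_fun n \<phi> r) (dual_multinomial n \<upsilon>)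
       = a \<upsilon>"
proof -
  have "simplex_inner n (\<lambda>r. \<Sum>\<phi>\<in>multisets_on_of_size n K. a \<phi> * multinomial_fun n \<phi> r) (dual_multinomial n \<upsilon>)
      = (\<Sum>\<phi>\<in>multisets_on_of_size n K. a \<phi> * simplex_inner n (multinomial_fun n \<phi>) (dual_multinomial n \<upsilon>))"
    using assms by (intro simplex_inner_sum_dual) (auto simp: multisets_of_size_iff)
  also have "\<dots> = (\<Sum>\<phi>\<in>multisets_on_of_size n K. if \<phi> = \<upsilon> then a \<upsilon> else 0)"
    using assms dual_multinomial(2)[of n \<upsilon>] by (intro sum.cong) (auto simp: multisets_of_size_iff)
  also have "\<dots> = a \<upsilon>"
    using assms by (simp add: finite_multisets_on_of_size)
  finally show ?thesis .
qed

section \<open>Composition with the signed hypergeometric channel\<close>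

lemma shg_eq_inner:
  "\<phi> \<in> multisets_on_of_size n K \<Longrightarrow>
     shg n K \<upsilon> \<phi> = simplex_inner n (multinomial_fun n \<phi>) (dual_multinomial n \<upsilon>)"
  by (simp add: shg_def simplex_inner_def)

text \<open>Exchanges the support of \<open>c x\<close>, which varies with \<open>x\<close>, for a
  fixed finite index set.\<close>

lemma channel_comp_eq_sum:
  assumes "\<And>y. y \<notin> multisets_on_of_size n K \<Longrightarrow> c x y = 0"
  shows "(d \<circ>\<^sub>c c) x z = (\<Sum>y\<in>multisets_on_of_size n K. c x y * d y z)"
  unfolding channel_comp_def using assms
  by (intro sum.mono_neutral_left) (auto intro: finite_multisets_on_of_size)

lemma channel_comp_shg_eq_sum:
  "(d \<circ>\<^sub>c shg n K) \<upsilon> z = (\<Sum>y\<in>multisets_on_of_size n K. shg n K \<upsilon> y * d y z)"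
  by (rule channel_comp_eq_sum) (simp add: shg_def)

text \<open>By linearity, \<open>d\<close> enters only through a function on the simplex. Equal
  functions therefore give equal composites, even when they are written with multinomials of
  different sizes.\<close>

lemma channel_comp_shg:
  assumes "n \<ge> 1" "\<upsilon> \<in> multisets_on n"
  shows "(d \<circ>\<^sub>c shg n K) \<upsilon> z =
    simplex_inner n (\<lambda>r. \<Sum>y\<in>multisets_on_of_size n K. d y z * multinomial_fun n y r) (dual_multinomial n \<upsilon>)"
proof -
  have "(d \<circ>\<^sub>c shg n K) \<upsilon> z = (\<Sum>y\<in>multisets_on_of_size n K. shg n K \<upsilon> y * d y z)"
    by (rule channel_comp_shg_eq_sum)
  also have "\<dots> = (\<Sum>y\<in>multisets_on_of_size n K. d y z * simplex_inner n (multinomial_fun n y) (dual_multinomial n \<upsilon>))"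
    by (intro sum.cong refl) (simp add: shg_eq_inner)
  also have "\<dots> = simplex_inner n (\<lambda>r. \<Sum>y\<in>multisets_on_of_size n K. d y z * multinomial_fun n y r) (dual_multinomial n \<upsilon>)"
    using assms by (intro simplex_inner_sum_dual[symmetric]) (auto simp: multisets_of_size_iff)
  finally show ?thesis .
qed

section \<open>Identities between multinomials on the simplex\<close>

text \<open>One more \<open>i\<close> multiplies the monomial by \<open>r i\<close>, the product of
  factorials by \<open>count \<phi> i + 1\<close>, and the factorial of the size by
  \<open>size \<phi> + 1\<close>.\<close>

lemma multinomial_fun_add_mset:
  assumes "i < n" "r \<in> simplex_vec n"
  shows "real (Suc (count \<phi> i)) * multinomial_fun n (add_mset i \<phi>) r =
         real (Suc (size \<phi>)) * (r i * multinomial_fun n \<phi> r)"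
proof -
  have remove_i: "(\<Prod>j<n. f j) = f i * (\<Prod>j\<in>{..<n} - {i}. f j)" for f :: "nat \<Rightarrow> real"
    using assms(1) by (intro prod.remove) auto
  have "(\<Prod>j\<in>{..<n} - {i}. fact (count (add_mset i \<phi>) j) :: real) = (\<Prod>j\<in>{..<n} - {i}. fact (count \<phi> j))"
    "(\<Prod>j\<in>{..<n} - {i}. r j ^ count (add_mset i \<phi>) j) = (\<Prod>j\<in>{..<n} - {i}. r j ^ count \<phi> j)"
    by (intro prod.cong; simp)+
  hence "(\<Prod>j<n. fact (count (add_mset i \<phi>) j) :: real) = real (Suc (count \<phi> i)) * (\<Prod>j<n. fact (count \<phi> j))"
    "(\<Prod>j<n. r j ^ count (add_mset i \<phi>) j) = r i * (\<Prod>j<n. r j ^ count \<phi> j)"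
    by (simp_all add: remove_i del: of_nat_Suc)
  thus ?thesis
    using assms(2) by (simp add: multinomial_fun_def del: of_nat_Suc)
qed

text \<open>Only multisets containing \<open>i\<close> contribute. These are exactly the
  \<open>add_mset i \<phi>\<close>, whose terms reduce to \<open>r i\<close> times the multinomial
  of \<phi>.\<close>

lemma sum_flrn_multinomial_fun_Suc:
  assumes "i < n" "r \<in> simplex_vec n"
  shows "(\<Sum>y\<in>multisets_on_of_size n (Suc K). flrn y i * multinomial_fun n y r) =
         r i * (\<Sum>\<phi>\<in>multisets_on_of_size n K. multinomial_fun n \<phi> r)"
proof -
  have "(\<Sum>y\<in>multisets_on_of_size n (Suc K). flrn y i * multinomial_fun n y r)
      = (\<Sum>y\<in>add_mset i ` multisets_on_of_size n K. flrn y i * multinomial_fun n y r)"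
  proof (intro sum.mono_neutral_right finite_multisets_on_of_size ballI)
    show "add_mset i ` multisets_on_of_size n K \<subseteq> multisets_on_of_size n (Suc K)"
      using assms(1) by (auto simp: multisets_of_size_def)
    fix y assume y: "y \<in> multisets_on_of_size n (Suc K) - add_mset i ` multisets_on_of_size n K"
    have "i \<notin># y"
    proof
      assume "i \<in># y"
      hence "y = add_mset i (y - {#i#})" by simp
      moreover have "y - {#i#} \<in> multisets_on_of_size n K"
        using y \<open>i \<in># y\<close> by (auto simp: multisets_of_size_def size_Diff_singleton dest: in_diffD)
      ultimately show False using y by blast
    qed
    thus "flrn y i * multinomial_fun n y r = 0" by (simp add: flrn_def not_in_iff)
  qed
  also have "\<dots> = (\<Sum>\<phi>\<in>multisets_on_of_size n K. flrn (add_mset i \<phi>) i * multinomial_fun n (add_mset i \<phi>) r)"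
    by (subst sum.reindex) (auto simp: inj_on_def)
  also have "\<dots> = (\<Sum>\<phi>\<in>multisets_on_of_size n K. r i * multinomial_fun n \<phi> r)"
  proof (intro sum.cong refl)
    fix \<phi> assume "\<phi> \<in> multisets_on_of_size n K"
    have "flrn (add_mset i \<phi>) i * multinomial_fun n (add_mset i \<phi>) r
        = real (Suc (count \<phi> i)) * multinomial_fun n (add_mset i \<phi>) r / real (Suc (size \<phi>))"
      by (simp add: flrn_def)
    thus "flrn (add_mset i \<phi>) i * multinomial_fun n (add_mset i \<phi>) r = r i * multinomial_fun n \<phi> r"
      unfolding multinomial_fun_add_mset[OF assms] by (simp del: of_nat_Suc)
  qed
  finally show ?thesis by (simp add: sum_distrib_left)
qed

lemma sum_flrn:
  assumes "y \<in> multisets_on n" "y \<noteq> {#}"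
  shows "(\<Sum>i<n. flrn y i) = 1"
proof -
  have "(\<Sum>i<n. flrn y i) = real (\<Sum>i<n. count y i) / real (size y)"
    by (simp add: flrn_def sum_divide_distrib)
  thus ?thesis using assms by (simp only: size_eq_sum_count[OF assms(1), symmetric]) simp
qed

text \<open>The multinomial theorem. Inserting the weights \<open>flrn y i\<close>, which sum to 1
  over \<open>i\<close>, splits off one draw and reduces the size by one.\<close>

lemma sum_multinomial_fun:
  assumes "r \<in> simplex_vec n"
  shows "(\<Sum>\<phi>\<in>multisets_on_of_size n K. multinomial_fun n \<phi> r) = 1"
proof (induction K)
  case 0
  show ?case using assms by (simp add: multinomial_fun_def)
next
  case (Suc K)
  let ?M = "multisets_on_of_size n (Suc K)"
  have "(\<Sum>y\<in>?M. multinomial_fun n y r) = (\<Sum>y\<in>?M. (\<Sum>i<n. flrn y i) * multinomial_fun n y r)"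
  proof (intro sum.cong refl)
    fix y assume "y \<in> ?M"
    hence "y \<in> multisets_on n" "y \<noteq> {#}" by (auto simp: multisets_of_size_iff)
    thus "multinomial_fun n y r = (\<Sum>i<n. flrn y i) * multinomial_fun n y r"
      by (simp add: sum_flrn)
  qed
  also have "\<dots> = (\<Sum>i<n. \<Sum>y\<in>?M. flrn y i * multinomial_fun n y r)"
    unfolding sum_distrib_right by (rule sum.swap)
  also have "\<dots> = (\<Sum>i<n. r i)"
    using assms Suc.IH by (intro sum.cong refl) (simp add: sum_flrn_multinomial_fun_Suc)
  finally show ?case using assms by (simp add: simplex_vec_def)
qed

text \<open>The right-hand side does not depend on \<open>K\<close>, so in a pairing the size
  \<open>K\<close> may be exchanged for any other positive size.\<close>

lemma sum_flrn_multinomial_fun: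
  assumes "i < n" "K \<ge> 1"
  shows "(\<lambda>r. \<Sum>y\<in>multisets_on_of_size n K. flrn y i * multinomial_fun n y r)
       = (\<lambda>r. if r \<in> simplex_vec n then r i else 0)"
proof
  obtain K' where "K = Suc K'" using assms(2) by (cases K) auto
  thus "(\<Sum>y\<in>multisets_on_of_size n K. flrn y i * multinomial_fun n y r)
      = (if r \<in> simplex_vec n then r i else 0)" for r
    using assms(1)
    by (auto simp: sum_flrn_multinomial_fun_Suc sum_multinomial_fun) (simp add: multinomial_fun_def)
qed

text \<open>Deleting \<open>i\<close> from \<open>y\<close> gives \<phi> exactly when adding
  \<open>i\<close> to \<phi> gives \<open>y\<close>. The new range \<open>i < n\<close> is the same
  for all \<open>y\<close>, which permits interchanging sums.\<close>

lemma draw_delete_eq: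
  assumes "y \<in> multisets_on n"
  shows "draw_delete K y \<phi> = (\<Sum>i<n. if y = add_mset i \<phi> then real (Suc (count \<phi> i)) / real (K + 1) else 0)"
proof -
  have "draw_delete K y \<phi> =
     (\<Sum>i\<in>set_mset y. if y = add_mset i \<phi> then real (Suc (count \<phi> i)) / real (K + 1) else 0)"
    unfolding draw_delete_def by (intro sum.cong refl) auto
  also have "\<dots> = (\<Sum>i<n. if y = add_mset i \<phi> then real (Suc (count \<phi> i)) / real (K + 1) else 0)"
    using assms by (intro sum.mono_neutral_left) (auto simp: multisets_on_def)
  finally show ?thesis .
qed

text \<open>Degree elevation, as for Bernstein polynomials: each \<open>i\<close> selects the single
  \<open>y = add_mset i \<phi>\<close> and contributes \<open>r i\<close> times the multinomial of
  \<phi>, and the \<open>r i\<close> sum to 1.\<close>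

lemma sum_draw_delete_multinomial_fun:
  assumes \<phi>: "\<phi> \<in> multisets_on_of_size n K"
  shows "(\<lambda>r. \<Sum>y\<in>multisets_on_of_size n (Suc K). draw_delete K y \<phi> * multinomial_fun n y r)
       = multinomial_fun n \<phi>"
proof
  fix r
  let ?M = "multisets_on_of_size n (Suc K)"
  show "(\<Sum>y\<in>?M. draw_delete K y \<phi> * multinomial_fun n y r) = multinomial_fun n \<phi> r"
  proof (cases "r \<in> simplex_vec n")
    case True
    have "(\<Sum>y\<in>?M. draw_delete K y \<phi> * multinomial_fun n y r) =
      (\<Sum>y\<in>?M. \<Sum>i<n. if y = add_mset i \<phi> then real (Suc (count \<phi> i)) / real (K + 1) * multinomial_fun n y r else 0)"
      by (intro sum.cong refl)
         (auto simp: draw_delete_eq multisets_of_size_iff sum_distrib_right intro!: sum.cong)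
    also have "\<dots> = (\<Sum>i<n. \<Sum>y\<in>?M. if y = add_mset i \<phi> then real (Suc (count \<phi> i)) / real (K + 1) * multinomial_fun n y r else 0)"
      by (rule sum.swap)
    also have "\<dots> = (\<Sum>i<n. r i * multinomial_fun n \<phi> r)"
    proof (intro sum.cong refl)
      fix i assume i: "i \<in> {..<n}"
      hence "add_mset i \<phi> \<in> ?M" using \<phi> by (simp add: multisets_of_size_def)
      hence "(\<Sum>y\<in>?M. if y = add_mset i \<phi> then real (Suc (count \<phi> i)) / real (K + 1) * multinomial_fun n y r else 0)
          = real (Suc (count \<phi> i)) * multinomial_fun n (add_mset i \<phi>) r / real (K + 1)"
        by (simp add: finite_multisets_on_of_size)
      also have "\<dots> = r i * multinomial_fun n \<phi> r"
        using \<phi> i True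
        by (subst multinomial_fun_add_mset) (auto simp: multisets_of_size_def simp del: of_nat_Suc)
      finally show "(\<Sum>y\<in>?M. if y = add_mset i \<phi> then real (Suc (count \<phi> i)) / real (K + 1) * multinomial_fun n y r else 0)
          = r i * multinomial_fun n \<phi> r" .
    qed
    also have "\<dots> = multinomial_fun n \<phi> r"
      using True by (simp add: sum_distrib_right[symmetric] simplex_vec_def)
    finally show ?thesis .
  qed (simp add: multinomial_fun_def)
qed

text \<open>Iterated degree elevation. Existence of the coefficients suffices, because pairing with
  dual multinomials identifies them afterwards.\<close>

lemma multinomial_fun_elevate:
  assumes "\<phi> \<in> multisets_on_of_size n K"
  shows "\<exists>c. multinomial_fun n \<phi> = (\<lambda>r. \<Sum>y\<in>multisets_on_of_size n (K + L). c y * multinomial_fun n y r)"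
proof (induction L)
  case 0
  have "multinomial_fun n \<phi> \<in> simplex_polys n K"
    unfolding simplex_polys_def using assms by (intro fun_space.span_base imageI)
  thus ?case by (simp add: simplex_polys_iff)
next
  case (Suc L)
  then obtain c where "multinomial_fun n \<phi> = (\<lambda>r. \<Sum>y\<in>multisets_on_of_size n (K + L). c y * multinomial_fun n y r)"
    by blast
  also have "\<dots> = (\<lambda>r. \<Sum>y\<in>multisets_on_of_size n (K + L). c y *
      (\<Sum>z\<in>multisets_on_of_size n (Suc (K + L)). draw_delete (K + L) z y * multinomial_fun n z r))"
    by (intro ext sum.cong refl) (simp add: sum_draw_delete_multinomial_fun[THEN fun_cong])
  also have "\<dots> = (\<lambda>r. \<Sum>z\<in>multisets_on_of_size n (Suc (K + L)).
      (\<Sum>y\<in>multisets_on_of_size n (K + L). c y * draw_delete (K + L) z y) * multinomial_fun n z r)"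
    unfolding sum_distrib_left sum_distrib_right mult.assoc by (intro ext sum.swap)
  finally show ?case 
    unfolding add_Suc_right
    by (rule exI[of _ "\<lambda>z. \<Sum>y\<in>multisets_on_of_size n (K + L). c y * draw_delete (K + L) z y"])
qed

text \<open>The coefficient at \<open>y\<close> of an expansion in size \<open>K + L\<close> is the
  pairing with the dual multinomial of \<open>y\<close>, which is \<open>shg n K y \<phi>\<close> by
  definition.\<close>

lemma multinomial_fun_eq_sum_shg:
  assumes "n \<ge> 1" "\<phi> \<in> multisets_on_of_size n K"
  shows "(\<lambda>r. \<Sum>y\<in>multisets_on_of_size n (K + L). shg n K y \<phi> * multinomial_fun n y r) = multinomial_fun n \<phi>"
proof -
  obtain c where c: "multinomial_fun n \<phi> = (\<lambda>r. \<Sum>y\<in>multisets_on_of_size n (K + L). c y * multinomial_fun n y r)"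
    using multinomial_fun_elevate[OF assms(2)] by blast
  have "shg n K y \<phi> = c y" if "y \<in> multisets_on_of_size n (K + L)" for y
    using simplex_inner_dual_coeff[OF assms(1) that, of c] assms(2) by (simp add: shg_eq_inner c)
  thus ?thesis by (simp add: c)
qed

section \<open>Total mass and the empty multiset\<close>

text \<open>The constant 1 on the simplex is the sum of all multinomials of size \<open>K\<close>
  and also of size \<open>size \<upsilon>\<close>. In the second form its coefficient at \<upsilon>
  is 1.\<close>

lemma sum_shg:
  assumes "n \<ge> 1" "\<upsilon> \<in> multisets_on n"
  shows "(\<Sum>\<phi>\<in>multisets_on_of_size n K. shg n K \<upsilon> \<phi>) = 1"
proof -
  let ?one = "\<lambda>M r. \<Sum>y\<in>multisets_on_of_size n M. 1 * multinomial_fun n y r"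
  have "?one M r = (if r \<in> simplex_vec n then 1 else 0)" for M r
    using sum_multinomial_fun[of r n M] by (simp add: multinomial_fun_def)
  hence "?one K = ?one (size \<upsilon>)" by (simp only:)
  hence "simplex_inner n (?one K) (dual_multinomial n \<upsilon>) = simplex_inner n (?one (size \<upsilon>)) (dual_multinomial n \<upsilon>)"
    by simp
  also have "\<dots> = 1"
    using assms by (intro simplex_inner_dual_coeff) (auto simp: multisets_of_size_iff)
  finally show ?thesis
    \<comment> \<open>Composing with the constant 1 gives the total mass; the output argument is
      arbitrary since the constant ignores it.\<close>
    using channel_comp_shg[OF assms, of "\<lambda>_ _. 1" K undefined] by (simp add: channel_comp_shg_eq_sum)
qed

text \<open>The dual multinomial of \<open>{#}\<close> is constant on the simplex, and all
  multinomials of size \<open>K\<close> have the same integral. The constant is left undetermined,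
  as the total mass fixes it.\<close>

lemma shg_empty_const:
  assumes "n \<ge> 1"
  shows "\<exists>c. \<forall>\<phi>\<in>multisets_on_of_size n K. shg n K {#} \<phi> = c"
proof -
  have empty: "{#} \<in> multisets_on n" by (simp add: multisets_on_def)
  obtain a where a: "dual_multinomial n {#} = (\<lambda>r. a * multinomial_fun n {#} r)"
    using dual_multinomial(1)[OF assms empty] by (auto simp: simplex_polys_iff)
  have "shg n K {#} \<phi> = a * (fact K / fact (K + n - 1))" if "\<phi> \<in> multisets_on_of_size n K" for \<phi>
  proof -
    have \<phi>: "\<phi> \<in> multisets_on n" "size \<phi> = K" using that by (auto simp: multisets_of_size_iff)
    have "shg n K {#} \<phi> = a * simplex_inner n (multinomial_fun n \<phi>) (multinomial_fun n {#})"
      using simplex_inner_sums[OF assms, of "{\<phi>}" "{{#}}" "\<lambda>_. 1" "\<lambda>_. a"] that \<phi> empty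
      by (simp add: shg_eq_inner a)
    also have "\<dots> = a * (fact K / fact (K + n - 1))"
      unfolding multinomial_inner[OF assms \<phi>(1) empty] using \<phi>(2) by simp
    finally show ?thesis .
  qed
  thus ?thesis by blast
qed

lemma shg_empty_uniform:
  assumes "n \<ge> 1" "\<phi> \<in> multisets_on_of_size n K"
  shows "shg n K {#} \<phi> = pmf (pmf_of_set (multisets_on_of_size n K)) \<phi>"
proof -
  obtain c where c: "\<And>\<phi>. \<phi> \<in> multisets_on_of_size n K \<Longrightarrow> shg n K {#} \<phi> = c"
    using shg_empty_const[OF assms(1)] by blast
  have "real (card (multisets_on_of_size n K)) * c = 1"
    using sum_shg[OF assms(1), of "{#}" K] by (simp add: c multisets_on_def)
  moreover have "multisets_on_of_size n K \<noteq> {}" using assms(2) by blast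
  ultimately show ?thesis
    using assms(2) finite_multisets_on_of_size[of n K] by (simp add: c field_simps)
qed

theorem proposition16:
  fixes n K L :: nat
  assumes "n \<ge> 1"
  shows "(\<forall>\<phi> \<in> multisets_on_of_size n K.
            shg n K {#} \<phi> = pmf (pmf_of_set (multisets_on_of_size n K)) \<phi>)
       \<and> (K \<ge> 1 \<longrightarrow>
            (\<forall>\<upsilon> \<in> multisets_on n - {{#}}. \<forall>i<n. (flrn \<circ>\<^sub>c shg n K) \<upsilon> i = flrn \<upsilon> i))
       \<and> (\<forall>r \<in> simplex_vec n. \<forall>\<phi> \<in> multisets_on_of_size n K.
            (shg n K \<circ>\<^sub>c multinomial_channel n (L + K)) r \<phi> = multinomial_channel n K r \<phi>)
       \<and> (\<forall>\<upsilon> \<in> multisets_on n. \<forall>\<phi> \<in> multisets_on_of_size n K.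
            (shg n K \<circ>\<^sub>c shg n (K + L)) \<upsilon> \<phi> = shg n K \<upsilon> \<phi>)
       \<and> (\<forall>\<upsilon> \<in> multisets_on n. \<forall>\<phi> \<in> multisets_on_of_size n K.
            (draw_delete K \<circ>\<^sub>c shg n (K + 1)) \<upsilon> \<phi> = shg n K \<upsilon> \<phi>)"
proof (intro conjI impI ballI allI)
  show "shg n K {#} \<phi> = pmf (pmf_of_set (multisets_on_of_size n K)) \<phi>"
    if "\<phi> \<in> multisets_on_of_size n K" for \<phi>
    using assms that by (rule shg_empty_uniform)
next
  fix \<upsilon> i assume K: "K \<ge> 1" and \<upsilon>: "\<upsilon> \<in> multisets_on n - {{#}}" and i: "i < n"
  \<comment> \<open>The function being paired is \<open>r i\<close> for every positive size. Writing
    it in size \<open>size \<upsilon>\<close>, which is positive as \<upsilon> is non-empty, makes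
    the pairing read off a coefficient.\<close>
  have "(flrn \<circ>\<^sub>c shg n K) \<upsilon> i = simplex_inner n
      (\<lambda>r. \<Sum>y\<in>multisets_on_of_size n (size \<upsilon>). flrn y i * multinomial_fun n y r) (dual_multinomial n \<upsilon>)"
    using assms K \<upsilon> i by (simp add: channel_comp_shg sum_flrn_multinomial_fun Suc_leI nonempty_has_size)
  also have "\<dots> = flrn \<upsilon> i"
    using assms \<upsilon> by (intro simplex_inner_dual_coeff) (auto simp: multisets_of_size_iff)
  finally show "(flrn \<circ>\<^sub>c shg n K) \<upsilon> i = flrn \<upsilon> i" .
next
  fix r \<phi> assume "r \<in> simplex_vec n" and \<phi>: "\<phi> \<in> multisets_on_of_size n K"
  have "(shg n K \<circ>\<^sub>c multinomial_channel n (L + K)) r \<phi>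
      = (\<Sum>y\<in>multisets_on_of_size n (L + K). multinomial_channel n (L + K) r y * shg n K y \<phi>)"
    by (rule channel_comp_eq_sum) (simp add: multinomial_channel_def)
  also have "\<dots> = (\<Sum>y\<in>multisets_on_of_size n (K + L). shg n K y \<phi> * multinomial_fun n y r)"
    by (intro sum.cong) (simp_all add: multinomial_channel_def add.commute)
  also have "\<dots> = multinomial_channel n K r \<phi>"
    using multinomial_fun_eq_sum_shg[OF assms \<phi>, of L, THEN fun_cong, of r] \<phi>
    by (simp add: multinomial_channel_def)
  finally show "(shg n K \<circ>\<^sub>c multinomial_channel n (L + K)) r \<phi> = multinomial_channel n K r \<phi>" .
next
  fix \<upsilon> \<phi> assume \<upsilon>: "\<upsilon> \<in> multisets_on n" and \<phi>: "\<phi> \<in> multisets_on_of_size n K"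
  show "(shg n K \<circ>\<^sub>c shg n (K + L)) \<upsilon> \<phi> = shg n K \<upsilon> \<phi>"
    unfolding channel_comp_shg[OF assms \<upsilon>] multinomial_fun_eq_sum_shg[OF assms \<phi>]
    using \<phi> by (rule shg_eq_inner[symmetric])
  show "(draw_delete K \<circ>\<^sub>c shg n (K + 1)) \<upsilon> \<phi> = shg n K \<upsilon> \<phi>"
    using assms \<upsilon> \<phi> by (simp add: channel_comp_shg sum_draw_delete_multinomial_fun shg_eq_inner)
qed

end
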